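(* Let $X$ be an infinite-dimensional reflexive real Banach space with topological dual $X^*$, and let $T:X\to X^*$ be a continuous potential operator. For $x\in X$ put $J_T(x)=\int_0^1 T(sx)(x)\,ds$. Assume that $T$ is closed and non-monotone, that $J_T$ is sequentially weakly lower semicontinuous, and that $J_T+\varphi$ is coercive for every $\varphi\in X^*$. Let $S_T\subseteq X$ be the set of all singular points of $T$. Then neither $S_T$ nor $T(S_T)$ is $\sigma$-compact.
   Context: $X$ and $X^*$ carry their norm topologies. A continuous operator $T:X\to X^*$ is a potential operator if the functional $J_T(x)=\int_0^1 T(sx)(x)\,ds$ is of class $C^1$ on $X$ and its Gâteaux derivative is equal to $T$. $T$ is monotone if $(T(x)-T(y))(x-y)\ge 0$ for all $x,y\in X$; non-monotone means not monotone. $T$ is closed if for each closed set $C\subseteq X$ the set $T(C)$ is closed in $X^*$. $T$ is a local homeomorphism at $x_0\in X$ if there are a neighbourhood $U$ of $x_0$ and a neighbourhood $V$ of $T(x_0)$ such that the restriction of $T$ to $U$ is a homeomorphism between $U$ and $V$. If $T$ is not a local homeomorphism at $x_0$, then $x_0$ is called a singular point of $T$. A functional $I:X\to\mathbb{R}$ is coercive if $\lim_{\|x\|\to+\infty}I(x)=+\infty$. A set in a topological space is $\sigma$-compact if it is the union of an at most countable family of compact sets. *)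

theory Defs
  imports "HOL-Analysis.Analysis"
begin

text \<open>Throughout, the dual space of \<open>'a\<close> is the type \<open>'a \<Rightarrow>\<^sub>L real\<close> with the operator norm.\<close>

definition infinite_dimensional :: "'a::real_vector itself \<Rightarrow> bool" where
  "infinite_dimensional _ \<longleftrightarrow> \<not> (\<exists>B::'a set. finite B \<and> span B = UNIV)"

text \<open>Reflexivity: the canonical embedding into the bidual is onto.\<close>

definition reflexive_space :: "'a::real_normed_vector itself \<Rightarrow> bool" where
  "reflexive_space _ \<longleftrightarrow>
    (\<forall>\<Phi> :: ('a \<Rightarrow>\<^sub>L real) \<Rightarrow>\<^sub>L real. \<exists>x::'a. \<forall>f. blinfun_apply \<Phi> f = blinfun_apply f x)"

definition J_functional :: "('a::real_normed_vector \<Rightarrow> 'a \<Rightarrow>\<^sub>L real) \<Rightarrow> 'a \<Rightarrow> real" where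
  "J_functional T x = integral {0..1} (\<lambda>s. blinfun_apply (T (s *\<^sub>R x)) x)"

definition C1_functional :: "('a::real_normed_vector \<Rightarrow> real) \<Rightarrow> bool" where
  "C1_functional I \<longleftrightarrow>
    (\<exists>D :: 'a \<Rightarrow> 'a \<Rightarrow>\<^sub>L real. continuous_on UNIV D \<and>
      (\<forall>x. (I has_derivative blinfun_apply (D x)) (at x)))"

definition has_gateaux_derivative ::
    "('a::real_normed_vector \<Rightarrow> real) \<Rightarrow> ('a \<Rightarrow>\<^sub>L real) \<Rightarrow> 'a \<Rightarrow> bool" where
  "has_gateaux_derivative I D x \<longleftrightarrow>
    (\<forall>v. ((\<lambda>t. (I (x + t *\<^sub>R v) - I x) / t) \<longlongrightarrow> blinfun_apply D v) (at (0::real)))"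

text \<open>Only meaningful for continuous \<open>T\<close>; continuity is assumed separately.\<close>

definition potential_operator :: "('a::real_normed_vector \<Rightarrow> 'a \<Rightarrow>\<^sub>L real) \<Rightarrow> bool" where
  "potential_operator T \<longleftrightarrow>
    C1_functional (J_functional T) \<and>
    (\<forall>x. has_gateaux_derivative (J_functional T) (T x) x)"

definition monotone_operator :: "('a::real_normed_vector \<Rightarrow> 'a \<Rightarrow>\<^sub>L real) \<Rightarrow> bool" where
  "monotone_operator T \<longleftrightarrow> (\<forall>x y. blinfun_apply (T x - T y) (x - y) \<ge> 0)"

definition weakly_converges :: "(nat \<Rightarrow> 'a::real_normed_vector) \<Rightarrow> 'a \<Rightarrow> bool" where
  "weakly_converges u x \<longleftrightarrow>
    (\<forall>f :: 'a \<Rightarrow>\<^sub>L real. (\<lambda>n. blinfun_apply f (u n)) \<longlonglongrightarrow> blinfun_apply f x)"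

text \<open>The lower limit is taken in the extended reals, as the sequence of values may be unbounded.\<close>

definition seq_weakly_lsc :: "('a::real_normed_vector \<Rightarrow> real) \<Rightarrow> bool" where
  "seq_weakly_lsc I \<longleftrightarrow>
    (\<forall>u x. weakly_converges u x \<longrightarrow> ereal (I x) \<le> liminf (\<lambda>n. ereal (I (u n))))"

text \<open>The filter \<open>at_infinity\<close> is generated by the sets \<open>{x. b \<le> norm x}\<close>.\<close>

definition coercive :: "('a::real_normed_vector \<Rightarrow> real) \<Rightarrow> bool" where
  "coercive I \<longleftrightarrow> filterlim I at_top at_infinity"

text \<open>Neighbourhoods are not required to be open.\<close>

definition local_homeomorphism_at ::
    "('a::topological_space \<Rightarrow> 'b::topological_space) \<Rightarrow> 'a \<Rightarrow> bool" where
  "local_homeomorphism_at T x \<longleftrightarrow>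
    (\<exists>U V. x \<in> interior U \<and> T x \<in> interior V \<and> (\<exists>g. homeomorphism U V T g))"

definition singular_points ::
    "('a::topological_space \<Rightarrow> 'b::topological_space) \<Rightarrow> 'a set" where
  "singular_points T = {x. \<not> local_homeomorphism_at T x}"

definition sigma_compact :: "'a::topological_space set \<Rightarrow> bool" where
  "sigma_compact S \<longleftrightarrow> (\<exists>\<K>. countable \<K> \<and> (\<forall>K\<in>\<K>. compact K) \<and> S = \<Union>\<K>)"

end

theory Submission
  imports Defs "HOL-Complex_Analysis.Great_Picard"
begin

text \<open>Write \<open>S\<close> for the singular set and suppose \<open>K = T(S)\<close> is \<open>\<sigma>\<close>-compact. Weak sequential compactness
  of bounded sets lets every \<open>J - \<phi>\<close> attain its minimum, so \<open>T\<close> is onto. Fibres of a closed map have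
  compact frontier, and the complement of a compact set is connected in infinite dimension, so the
  fibres are compact and \<open>T\<close> is proper; in particular \<open>T\<^sup>-\<^sup>1(K)\<close> is \<open>\<sigma>\<close>-compact too. A loop avoiding
  a \<open>\<sigma>\<close>-compact set can be coned off from a generic apex without meeting that set. Hence
  \<open>T\<close> restricts to a covering of the simply connected \<open>X\<^sup>* - K\<close> by the path connected
  \<open>X - T\<^sup>-\<^sup>1(K)\<close>, and is injective there. For \<open>x\<close> outside \<open>T\<^sup>-\<^sup>1(K)\<close> the minimizer of \<open>J - T(x)\<close>
  must then be \<open>x\<close> itself; adding the two minimality inequalities for \<open>x\<close> and \<open>y\<close> shows that \<open>T\<close>
  is monotone on a dense set, hence everywhere.\<close>

section \<open>The Hahn-Banach theorem\<close>

definition sublinear :: "('a::real_vector \<Rightarrow> real) \<Rightarrow> bool" where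
  "sublinear p \<longleftrightarrow> (\<forall>x y. p (x + y) \<le> p x + p y) \<and> (\<forall>c x. 0 \<le> c \<longrightarrow> p (c *\<^sub>R x) = c * p x)"

text \<open>The scaling inequality for all positive factors contains its own converse: apply it to
  \<open>c *\<^sub>R x\<close> with the factor \<open>inverse c\<close>.\<close>

lemma sublinearI:
  assumes "\<And>x y. p (x + y) \<le> p x + p y" and "\<And>c x. 0 < c \<Longrightarrow> p (c *\<^sub>R x) \<le> c * p x" and "p 0 = 0"
  shows "sublinear p"
  unfolding sublinear_def
proof (intro conjI allI impI)
  fix c :: real and x assume "0 \<le> c"
  show "p (c *\<^sub>R x) = c * p x"
  proof (cases "c = 0")
    case False
    then have c: "c > 0" using \<open>0 \<le> c\<close> by simp
    have "p x = p (inverse c *\<^sub>R (c *\<^sub>R x))" using c by simp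
    also have "\<dots> \<le> inverse c * p (c *\<^sub>R x)" by (rule assms(2)) (use c in simp)
    finally have "c * p x \<le> p (c *\<^sub>R x)" using c by (simp add: field_simps)
    then show ?thesis using assms(2)[OF c, of x] by simp
  qed (simp add: assms(3))
qed (rule assms(1))

lemma sublinear_add: "sublinear p \<Longrightarrow> p (x + y) \<le> p x + p y"
  and sublinear_scale: "sublinear p \<Longrightarrow> 0 \<le> c \<Longrightarrow> p (c *\<^sub>R x) = c * p x"
  by (auto simp: sublinear_def)

lemma sublinear_zero: "sublinear p \<Longrightarrow> p 0 = 0"
  using sublinear_scale[of p 0 0] by simp

lemma sublinear_minus: "sublinear p \<Longrightarrow> - p (- x) \<le> p x"
  using sublinear_add[of p x "- x"] sublinear_zero[of p] by simp

text \<open>The infimum of \<open>p (x + t *\<^sub>R v) - t * p v\<close> over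
  \<open>t \<ge> 0\<close> works, the parameters 0 and 1 giving the two bounds. At
  \<open>- v\<close> the second bound reads \<open>q (- v) \<le> - p v\<close>, which forces every
  linear functional below \<open>q\<close> to agree with \<open>p\<close> at
  \<open>v\<close>.\<close>

lemma sublinear_descend:
  assumes p: "sublinear p"
  obtains q where "sublinear q" "\<And>x. q x \<le> p x" "\<And>x. q x \<le> p (x + v) - p v"
proof -
  let ?S = "\<lambda>x. (\<lambda>t. p (x + t *\<^sub>R v) - t * p v) ` {0..}"
  define q where "q x = Inf (?S x)" for x
  \<comment> \<open>Splitting \<open>t *\<^sub>R v\<close> as
    \<open>(x + t *\<^sub>R v) + (- x)\<close> bounds the family from below, so the infimum is
    finite.\<close>
  have lb: "- p (- x) \<le> p (x + t *\<^sub>R v) - t * p v" if "0 \<le> t" for x t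
    using sublinear_add[OF p, of "x + t *\<^sub>R v" "- x"] sublinear_scale[OF p that, of v] by simp
  have bdd: "bdd_below (?S x)" for x
    using lb by (intro bdd_belowI[of _ "- p (- x)"]) auto
  have le: "q x \<le> p (x + t *\<^sub>R v) - t * p v" if "0 \<le> t" for x t
    unfolding q_def by (rule cInf_lower) (use that bdd in auto)
  have ge: "c \<le> q x" if "\<And>t. 0 \<le> t \<Longrightarrow> c \<le> p (x + t *\<^sub>R v) - t * p v" for c x
    unfolding q_def by (rule cInf_greatest) (use that in auto)
  have "sublinear q"
  proof (rule sublinearI)
    fix x y
    have "q (x + y) - (p (x + t *\<^sub>R v) - t * p v) \<le> q y" if t: "0 \<le> t" for t
    proof (rule ge)
      fix s :: real assume s: "0 \<le> s"
      have "q (x + y) \<le> p ((x + y) + (t + s) *\<^sub>R v) - (t + s) * p v"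
        by (rule le) (use s t in simp)
      also have "p ((x + y) + (t + s) *\<^sub>R v) \<le> p (x + t *\<^sub>R v) + p (y + s *\<^sub>R v)"
        using sublinear_add[OF p, of "x + t *\<^sub>R v" "y + s *\<^sub>R v"] by (simp add: algebra_simps)
      finally show "q (x + y) - (p (x + t *\<^sub>R v) - t * p v) \<le> p (y + s *\<^sub>R v) - s * p v"
        by (simp add: algebra_simps)
    qed
    then have "q (x + y) - q y \<le> p (x + t *\<^sub>R v) - t * p v" if "0 \<le> t" for t
      using that by (smt (verit))
    then have "q (x + y) - q y \<le> q x" by (rule ge)
    then show "q (x + y) \<le> q x + q y" by simp
  next
    fix c :: real and x assume c: "0 < c"
    have "q (c *\<^sub>R x) / c \<le> q x"
    proof (rule ge)
      fix t :: real assume t: "0 \<le> t"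
      have "q (c *\<^sub>R x) \<le> p (c *\<^sub>R x + (c * t) *\<^sub>R v) - (c * t) * p v"
        by (rule le) (use c t in simp)
      also have "p (c *\<^sub>R x + (c * t) *\<^sub>R v) = c * p (x + t *\<^sub>R v)"
        using sublinear_scale[OF p, of c "x + t *\<^sub>R v"] c by (simp add: algebra_simps)
      finally show "q (c *\<^sub>R x) / c \<le> p (x + t *\<^sub>R v) - t * p v"
        using c by (simp add: field_simps)
    qed
    then show "q (c *\<^sub>R x) \<le> c * q x" using c by (simp add: field_simps)
  next
    show "q 0 = 0"
      using le[of 0 0] ge[of 0 0] sublinear_scale[OF p, of _ v] sublinear_zero[OF p] by fastforce
  qed
  moreover have "q x \<le> p x" for x using le[of 0 x] by simp
  moreover have "q x \<le> p (x + v) - p v" for x using le[of 1 x] by simp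
  ultimately show thesis using that by blast
qed

text \<open>Hahn-Banach by way of minimal sublinear functionals: a minimal one equals all of its
  descents, which forces additivity.\<close>

lemma exists_minimal_sublinear:
  assumes p: "sublinear p"
  obtains m where "sublinear m" "\<And>x. m x \<le> p x"
    "\<And>q. sublinear q \<Longrightarrow> (\<And>x. q x \<le> m x) \<Longrightarrow> q = m"
proof -
  let ?A = "{q. sublinear q \<and> q \<le> p}"
  \<comment> \<open>The order is reversed so that Zorn's lemma yields a minimal functional; the
    bound of a nonempty chain is its pointwise infimum.\<close>
  let ?R = "relation_of (\<lambda>q r. r \<le> q) ?A"
  have po: "partial_order_on ?A ?R"
    by (auto simp: relation_of_def partial_order_on_def preorder_on_def refl_on_def trans_def
        antisym_def)
  have "\<exists>u\<in>?A. \<forall>a\<in>C. u \<le> a" if C: "C \<in> Chains ?R" for C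
  proof (cases "C = {}")
    case True then show ?thesis using p by auto
  next
    case False
    have CA: "sublinear q" "q \<le> p" if "q \<in> C" for q
      using C that by (auto simp: Chains_def relation_of_def)
    have tot: "q \<le> r \<or> r \<le> q" if "q \<in> C" "r \<in> C" for q r
      using C that by (auto simp: Chains_def relation_of_def)
    define u where "u x = (INF q\<in>C. q x)" for x
    have bdd: "bdd_below ((\<lambda>q. q x) ` C)" for x
    proof (rule bdd_belowI2)
      fix q assume q: "q \<in> C"
      have "- p (- x) \<le> - q (- x)" using CA(2)[OF q] by (simp add: le_fun_def)
      also have "\<dots> \<le> q x" by (rule sublinear_minus[OF CA(1)[OF q]])
      finally show "- p (- x) \<le> q x" .
    qed
    have le: "u x \<le> q x" if "q \<in> C" for x q
      unfolding u_def by (rule cINF_lower[OF bdd that])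
    have ge: "c \<le> u x" if "\<And>q. q \<in> C \<Longrightarrow> c \<le> q x" for c x
      unfolding u_def by (rule cINF_greatest[OF False that])
    have "sublinear u"
    proof (rule sublinearI)
      fix x y
      \<comment> \<open>Two members of the chain are both replaced by the smaller one, whose
        subadditivity then applies.\<close>
      have 1: "u (x + y) - q x \<le> r y" if qr: "q \<in> C" "r \<in> C" for q r
      proof -
        obtain s where s: "s \<in> C" "s \<le> q" "s \<le> r" using tot[OF qr] qr by auto
        have "u (x + y) \<le> s x + s y"
          using le[OF s(1), of "x + y"] sublinear_add[OF CA(1)[OF s(1)], of x y] by simp
        also have "\<dots> \<le> q x + r y" using s by (simp add: le_fun_def add_mono)
        finally show ?thesis by simp
      qed
      have "u (x + y) - u y \<le> q x" if "q \<in> C" for q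
        using ge[of "u (x + y) - q x" y] 1[OF that] by fastforce
      then have "u (x + y) - u y \<le> u x" by (rule ge)
      then show "u (x + y) \<le> u x + u y" by simp
    next
      fix c :: real and x assume c: "0 < c"
      have "u (c *\<^sub>R x) / c \<le> u x"
      proof (rule ge)
        fix q assume q: "q \<in> C"
        show "u (c *\<^sub>R x) / c \<le> q x"
          using le[OF q, of "c *\<^sub>R x"] sublinear_scale[OF CA(1)[OF q], of c x] c
          by (simp add: field_simps)
      qed
      then show "u (c *\<^sub>R x) \<le> c * u x" using c by (simp add: field_simps)
    next
      have "q 0 = 0" if "q \<in> C" for q by (rule sublinear_zero[OF CA(1)[OF that]])
      then have "(\<lambda>q. q 0) ` C = {0}" using False by force
      then show "u 0 = 0" unfolding u_def by simp
    qed
    moreover obtain q where "q \<in> C" using False by blast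
    then have "u \<le> p" using le CA(2) by (meson le_funI le_funD order_trans)
    ultimately show ?thesis using le by (auto simp: le_fun_def)
  qed
  then obtain m where "m \<in> ?A" "\<forall>a\<in>?A. a \<le> m \<longrightarrow> a = m"
    using predicate_Zorn[OF po] by blast
  then have "sublinear m" "\<And>x. m x \<le> p x"
      "\<And>q. sublinear q \<Longrightarrow> (\<And>x. q x \<le> m x) \<Longrightarrow> q = m"
    by (auto simp: le_fun_def) (metis order_trans)
  then show thesis using that by blast
qed

text \<open>The minimal functional \<open>m\<close> is taken below the descent of \<open>p\<close>
  along \<open>v\<close>, which fixes its value at \<open>v\<close>. By minimality \<open>m\<close>
  is its own descent along every \<open>y\<close>, so \<open>m x \<le> m (x + y) - m y\<close>, the
  converse of subadditivity.\<close>

theorem hahn_banach_sublinear: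
  fixes p :: "'a::real_vector \<Rightarrow> real"
  assumes p: "sublinear p"
  obtains f where "linear f" "\<And>x. f x \<le> p x" "f v = p v"
proof -
  obtain q where q: "sublinear q" "\<And>x. q x \<le> p x" "\<And>x. q x \<le> p (x + v) - p v"
    using sublinear_descend[OF p] by metis
  obtain m where m: "sublinear m" "\<And>x. m x \<le> q x"
      "\<And>r. sublinear r \<Longrightarrow> (\<And>x. r x \<le> m x) \<Longrightarrow> r = m"
    using exists_minimal_sublinear[OF q(1)] by metis
  have add: "m (x + y) = m x + m y" for x y
  proof -
    obtain r where r: "sublinear r" "\<And>z. r z \<le> m z" "\<And>z. r z \<le> m (z + y) - m y"
      using sublinear_descend[OF m(1)] by metis
    have "r = m" using r m(3) by blast
    then show ?thesis using r(3)[of x] sublinear_add[OF m(1), of x y] by simp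
  qed
  have neg: "m (- x) = - m x" for x
    using add[of x "- x"] sublinear_zero[OF m(1)] by simp
  have scale: "m (c *\<^sub>R x) = c * m x" for c x
  proof (cases "0 \<le> c")
    case True then show ?thesis by (rule sublinear_scale[OF m(1)])
  next
    case False
    then show ?thesis using sublinear_scale[OF m(1), of "- c" x] neg[of "c *\<^sub>R x"] by simp
  qed
  have "linear m" by (rule linearI) (simp_all add: add scale)
  moreover have le: "m x \<le> p x" for x using m(2) q(2) order_trans by blast
  moreover have "m v = p v"
    using m(2)[of "- v"] q(3)[of "- v"] neg[of v] sublinear_zero[OF p] le[of v] by simp
  ultimately show thesis using that by blast
qed

text \<open>Domination at both \<open>x\<close> and \<open>- x\<close> bounds the absolute value of
  the linear functional, which makes it continuous.\<close>

lemma hahn_banach_blinfun: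
  fixes p :: "'a::real_normed_vector \<Rightarrow> real"
  assumes p: "sublinear p" and C: "\<And>x. p x \<le> C * norm x"
  obtains f :: "'a \<Rightarrow>\<^sub>L real" where "\<And>x. f x \<le> p x" "f v = p v"
proof -
  obtain f where f: "linear f" "\<And>x. f x \<le> p x" "f v = p v"
    using hahn_banach_sublinear[OF p] by metis
  have "norm (f x) \<le> norm x * C" for x
    using f(2)[of x] f(2)[of "- x"] C[of x] C[of "- x"] linear_neg[OF f(1), of x]
    by (simp add: mult.commute)
  then have "bounded_linear f"
    using f(1) by (intro bounded_linear_intro[of f C]) (auto simp: linear_add linear_scale)
  then show thesis using f that[of "Blinfun f"] by (simp add: bounded_linear_Blinfun_apply)
qed

section \<open>Norming and separating functionals\<close>

lemma norming_functional:
  fixes v :: "'a::real_normed_vector"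
  obtains f :: "'a \<Rightarrow>\<^sub>L real" where "\<And>x. \<bar>f x\<bar> \<le> norm x" "f v = norm v"
proof -
  have "sublinear (norm :: 'a \<Rightarrow> real)"
    by (rule sublinearI) (auto intro: norm_triangle_ineq)
  then obtain f :: "'a \<Rightarrow>\<^sub>L real" where f: "\<And>x. f x \<le> norm x" "f v = norm v"
    using hahn_banach_blinfun[of norm 1 v] by auto
  have "\<bar>f x\<bar> \<le> norm x" for x
    using f(1)[of x] f(1)[of "- x"] by (simp add: blinfun.minus_right)
  then show thesis using f(2) that by blast
qed

lemma infdist_lessE:
  assumes "infdist x A < r" and "A \<noteq> {}"
  obtains a where "a \<in> A" "dist x a < r"
  using assms cInf_lessD[of "dist x ` A" r] by (auto simp: infdist_def)

text \<open>The distance to \<open>M\<close> is sublinear, dominated by the norm, and zero exactly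
  on the closed set \<open>M\<close>. A functional below it vanishes on \<open>M\<close>, because
  \<open>M\<close> contains \<open>- x\<close> along with \<open>x\<close>, and it can be made to
  attain the distance at \<open>v\<close>.\<close>

lemma separating_functional:
  fixes M :: "'a::real_normed_vector set"
  assumes M: "subspace M" "closed M" and v: "v \<notin> M"
  obtains f :: "'a \<Rightarrow>\<^sub>L real" where "\<And>x. x \<in> M \<Longrightarrow> f x = 0" "f v \<noteq> 0"
proof -
  have ne: "M \<noteq> {}" using subspace_0[OF M(1)] by blast
  have "sublinear (\<lambda>x. infdist x M)"
  proof (rule sublinearI)
    fix x y
    show "infdist (x + y) M \<le> infdist x M + infdist y M"
    proof (rule field_le_epsilon)
      fix e :: real assume e: "0 < e"
      obtain a where a: "a \<in> M" "dist x a < infdist x M + e/2"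
        using infdist_lessE[of x M "infdist x M + e/2"] e ne by auto
      obtain b where b: "b \<in> M" "dist y b < infdist y M + e/2"
        using infdist_lessE[of y M "infdist y M + e/2"] e ne by auto
      have "infdist (x + y) M \<le> dist (x + y) (a + b)"
        by (rule infdist_le) (use a b M(1) in \<open>auto intro: subspace_add\<close>)
      also have "\<dots> \<le> dist x a + dist y b"
        by (rule dist_triangle_add)
      finally show "infdist (x + y) M \<le> infdist x M + infdist y M + e" using a b by simp
    qed
  next
    fix c :: real and x assume c: "0 < c"
    show "infdist (c *\<^sub>R x) M \<le> c * infdist x M"
    proof (rule field_le_epsilon)
      fix e :: real assume e: "0 < e"
      obtain a where a: "a \<in> M" "dist x a < infdist x M + e/c"
        using infdist_lessE[of x M "infdist x M + e/c"] e c ne by auto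
      have "infdist (c *\<^sub>R x) M \<le> dist (c *\<^sub>R x) (c *\<^sub>R a)"
        by (rule infdist_le) (use a M(1) in \<open>auto intro: subspace_scale\<close>)
      also have "\<dots> = c * dist x a"
        using c by (simp add: dist_norm flip: scaleR_diff_right)
      also have "\<dots> \<le> c * (infdist x M + e/c)" using a c by simp
      also have "\<dots> = c * infdist x M + e" using c by (simp add: field_simps)
      finally show "infdist (c *\<^sub>R x) M \<le> c * infdist x M + e" .
    qed
  next
    show "infdist 0 M = 0" using subspace_0[OF M(1)] by simp
  qed
  moreover have "infdist x M \<le> 1 * norm x" for x
    using infdist_le[OF subspace_0[OF M(1)], of x] by simp
  ultimately obtain f :: "'a \<Rightarrow>\<^sub>L real" where f: "\<And>x. f x \<le> infdist x M" "f v = infdist v M"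
    using hahn_banach_blinfun[of "\<lambda>x. infdist x M" 1 v] by metis
  have "f x = 0" if "x \<in> M" for x
    using f(1)[of x] f(1)[of "- x"] that subspace_neg[OF M(1) that]
    by (simp add: blinfun.minus_right)
  moreover have "f v \<noteq> 0"
    using f(2) v in_closed_iff_infdist_zero[OF M(2) ne] by auto
  ultimately show thesis using that by blast
qed

section \<open>Weak sequential compactness and minimizers\<close>

text \<open>Rational combinations of the sequence are countable and stable under sums and rational
  multiples; real multiples appear in the closure by approximating scalar and vector
  together.\<close>

lemma closed_separable_subspace_containing_seq:
  fixes u :: "nat \<Rightarrow> 'a::real_normed_vector"
  obtains D where "countable D" "subspace (closure D)" "range u \<subseteq> closure D"
proof -
  \<comment> \<open>\<open>E n\<close> consists of the rational combinations of the first
    \<open>n\<close> terms of \<open>u\<close>.\<close>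
  define E where "E = rec_nat {0} (\<lambda>n S. (\<lambda>(q, d). real_of_rat q *\<^sub>R u n + d) ` (UNIV \<times> S))"
  have E0: "E 0 = {0}"
    and ES: "E (Suc n) = (\<lambda>(q, d). real_of_rat q *\<^sub>R u n + d) ` (UNIV \<times> E n)" for n
    by (simp_all add: E_def)
  have ctb: "countable (E n)" for n
    by (induction n) (auto simp: E0 ES)
  have sub: "E n \<subseteq> E (Suc n)" for n
  proof
    fix d assume "d \<in> E n"
    then show "d \<in> E (Suc n)" unfolding ES by (intro image_eqI[where x = "(0, d)"]) auto
  qed
  have mono: "E m \<subseteq> E n" if "m \<le> n" for m n
    using sub that by (rule lift_Suc_mono_le)
  have add: "x + y \<in> E n" if "x \<in> E n" "y \<in> E n" for n x y
    using that
  proof (induction n arbitrary: x y)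
    case (Suc n)
    then obtain q d r e where "x = real_of_rat q *\<^sub>R u n + d" "d \<in> E n"
        "y = real_of_rat r *\<^sub>R u n + e" "e \<in> E n"
      by (auto simp: ES)
    then show ?case unfolding ES using Suc.IH
      by (intro image_eqI[where x = "(q + r, d + e)"]) (auto simp: of_rat_add algebra_simps)
  qed (simp add: E0)
  have scale: "real_of_rat c *\<^sub>R x \<in> E n" if "x \<in> E n" for n x c
    using that
  proof (induction n arbitrary: x)
    case (Suc n)
    then obtain q d where "x = real_of_rat q *\<^sub>R u n + d" "d \<in> E n"
      by (auto simp: ES)
    then show ?case unfolding ES using Suc.IH
      by (intro image_eqI[where x = "(c * q, real_of_rat c *\<^sub>R d)"])
        (auto simp: of_rat_mult algebra_simps)
  qed (simp add: E0)
  define D where "D = (\<Union>n. E n)"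
  have zero: "0 \<in> D" using E0 by (auto simp: D_def)
  have addD: "x + y \<in> D" if xy: "x \<in> D" "y \<in> D" for x y
  proof -
    obtain m n where "x \<in> E m" "y \<in> E n" using xy by (auto simp: D_def)
    then have "x \<in> E (max m n)" "y \<in> E (max m n)" using mono by (meson max.cobounded1 max.cobounded2 subsetD)+
    then show ?thesis using add by (auto simp: D_def)
  qed
  have scaleD: "real_of_rat c *\<^sub>R x \<in> D" if "x \<in> D" for c x
    using scale that by (auto simp: D_def)
  have "countable D" using ctb by (auto simp: D_def)
  moreover have "subspace (closure D)"
    unfolding subspace_def
  proof (intro conjI ballI allI)
    show "0 \<in> closure D" using zero closure_subset by blast
  next
    fix x y assume "x \<in> closure D" "y \<in> closure D"
    then obtain a b where "\<And>n. a n \<in> D" "a \<longlonglongrightarrow> x" "\<And>n. b n \<in> D" "b \<longlonglongrightarrow> y"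
      unfolding closure_sequential by blast
    then show "x + y \<in> closure D" unfolding closure_sequential
      by (intro exI[where x = "\<lambda>n. a n + b n"]) (auto intro: addD tendsto_add)
  next
    fix c :: real and x assume "x \<in> closure D"
    then obtain a where a: "\<And>n. a n \<in> D" "a \<longlonglongrightarrow> x"
      unfolding closure_sequential by blast
    have "c \<in> closure \<rat>" by (simp add: Rats_closure_real)
    then obtain b where b: "\<And>n. b n \<in> \<rat>" "b \<longlonglongrightarrow> c"
      unfolding closure_sequential by blast
    have "b n *\<^sub>R a n \<in> D" for n
      using b(1)[of n] a(1)[of n] scaleD by (auto elim!: Rats_cases)
    then show "c *\<^sub>R x \<in> closure D" unfolding closure_sequential
      by (intro exI[where x = "\<lambda>n. b n *\<^sub>R a n"]) (auto intro: tendsto_scaleR a b)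
  qed
  moreover have "range u \<subseteq> D"
  proof safe
    fix n
    have "0 \<in> E n" using mono[of 0 n] E0 by auto
    then have "u n \<in> E (Suc n)" unfolding ES
      by (intro image_eqI[where x = "(1, 0)"]) auto
    then show "u n \<in> D" by (auto simp: D_def)
  qed
  ultimately show thesis using that closure_subset by (metis subset_trans)
qed

text \<open>The upper limit of \<open>\<psi> (u n)\<close> is sublinear in \<open>\<psi>\<close>.
  Hahn-Banach on the dual gives a bidual element below it that agrees with it at
  \<open>\<phi>\<close>, and reflexivity represents this element by a point
  \<open>x\<close>.\<close>

lemma reflexive_space_limsup_attained:
  fixes u :: "nat \<Rightarrow> 'a::real_normed_vector" and \<phi> :: "'a \<Rightarrow>\<^sub>L real"
  assumes refl: "reflexive_space TYPE('a)" and bd: "\<And>n. norm (u n) \<le> R"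
  obtains x where "\<And>(\<psi> :: 'a \<Rightarrow>\<^sub>L real) c. \<forall>\<^sub>F n in sequentially. \<psi> (u n) \<le> c \<Longrightarrow> \<psi> x \<le> c"
    "\<And>c. \<phi> x < c \<Longrightarrow> \<forall>\<^sub>F n in sequentially. \<phi> (u n) \<le> c"
proof -
  \<comment> \<open>The upper limit is encoded as the infimum \<open>p \<psi>\<close> of the set
    \<open>S \<psi>\<close> of eventual upper bounds, which keeps it a real number.\<close>
  define S where "S \<psi> = {c. \<forall>\<^sub>F n in sequentially. blinfun_apply \<psi> (u n) \<le> c}" for \<psi> :: "'a \<Rightarrow>\<^sub>L real"
  define p where "p \<psi> = Inf (S \<psi>)" for \<psi>
  have abs_le: "\<bar>\<psi> (u n)\<bar> \<le> R * norm \<psi>" for \<psi> :: "'a \<Rightarrow>\<^sub>L real" and n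
  proof -
    have "\<bar>\<psi> (u n)\<bar> \<le> norm \<psi> * norm (u n)" using norm_blinfun[of \<psi> "u n"] by simp
    also have "\<dots> \<le> norm \<psi> * R" by (intro mult_left_mono bd) simp
    finally show ?thesis by (simp add: mult.commute)
  qed
  have top: "R * norm \<psi> \<in> S \<psi>" for \<psi>
    unfolding S_def using abs_le by (auto intro!: always_eventually simp: abs_le_iff)
  have "- (R * norm \<psi>) \<le> c" if "c \<in> S \<psi>" for c \<psi>
  proof -
    have "\<exists>n. blinfun_apply \<psi> (u n) \<le> c"
      using that unfolding S_def by (intro eventually_happens'[OF sequentially_bot]) simp
    then obtain n where "blinfun_apply \<psi> (u n) \<le> c" ..
    then show ?thesis using abs_le[of \<psi> n] by linarith
  qed
  then have bdd: "bdd_below (S \<psi>)" for \<psi> by (meson bdd_belowI)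
  have le: "p \<psi> \<le> c" if "c \<in> S \<psi>" for \<psi> c
    unfolding p_def by (rule cInf_lower[OF that bdd])
  have ge: "b \<le> p \<psi>" if "\<And>c. c \<in> S \<psi> \<Longrightarrow> b \<le> c" for \<psi> b
    unfolding p_def using top by (intro cInf_greatest that) auto
  have "sublinear p"
  proof (rule sublinearI)
    fix \<psi> \<eta>
    have 1: "p (\<psi> + \<eta>) \<le> c + d" if "c \<in> S \<psi>" "d \<in> S \<eta>" for c d
    proof (rule le)
      show "c + d \<in> S (\<psi> + \<eta>)" using that unfolding S_def mem_Collect_eq
        by (rule eventually_elim2) (simp add: blinfun.add_left)
    qed
    have "p (\<psi> + \<eta>) - c \<le> p \<eta>" if "c \<in> S \<psi>" for c
      using 1[OF that] by (intro ge) (simp add: algebra_simps)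
    then have "p (\<psi> + \<eta>) - p \<eta> \<le> p \<psi>" by (intro ge) (simp add: algebra_simps)
    then show "p (\<psi> + \<eta>) \<le> p \<psi> + p \<eta>" by simp
  next
    fix c :: real and \<psi> assume c: "0 < c"
    have "p (c *\<^sub>R \<psi>) / c \<le> p \<psi>"
    proof (rule ge)
      fix b assume "b \<in> S \<psi>"
      then have "c * b \<in> S (c *\<^sub>R \<psi>)" using c by (simp add: S_def blinfun.scaleR_left)
      then show "p (c *\<^sub>R \<psi>) / c \<le> b" using le[of "c * b" "c *\<^sub>R \<psi>"] c by (simp add: field_simps)
    qed
    then show "p (c *\<^sub>R \<psi>) \<le> c * p \<psi>" using c by (simp add: field_simps)
  next
    have "S 0 = {0..}" by (auto simp: S_def)
    then show "p 0 = 0" by (simp add: p_def)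
  qed
  moreover have "p \<psi> \<le> R * norm \<psi>" for \<psi> by (rule le[OF top])
  ultimately obtain F :: "('a \<Rightarrow>\<^sub>L real) \<Rightarrow>\<^sub>L real" where F: "\<And>\<psi>. F \<psi> \<le> p \<psi>" "F \<phi> = p \<phi>"
    using hahn_banach_blinfun[of p R \<phi>] by metis
  obtain x where x: "\<And>\<psi>. blinfun_apply F \<psi> = blinfun_apply \<psi> x"
    using refl unfolding reflexive_space_def by blast
  show thesis
  proof (rule that)
    fix \<psi> :: "'a \<Rightarrow>\<^sub>L real" and c assume "\<forall>\<^sub>F n in sequentially. \<psi> (u n) \<le> c"
    then have "p \<psi> \<le> c" by (intro le) (simp add: S_def)
    then show "\<psi> x \<le> c" using F(1)[of \<psi>] x[of \<psi>] by simp
  next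
    fix c assume "\<phi> x < c"
    then have "Inf (S \<phi>) < c" using F(2) x[of \<phi>] by (simp add: p_def)
    then obtain b where "b \<in> S \<phi>" "b < c" using cInf_lessD top by blast
    then show "\<forall>\<^sub>F n in sequentially. \<phi> (u n) \<le> c"
      unfolding S_def by (auto elim!: eventually_mono)
  qed
qed

text \<open>A diagonal subsequence converges under norming functionals for a countable set
  \<open>D\<close>. These functionals separate points of the closure of \<open>D\<close>, so there
  is only one cluster point; since each upper limit is attained at some cluster point, weak
  convergence follows.\<close>

theorem reflexive_space_bounded_seq:
  fixes u :: "nat \<Rightarrow> 'a::real_normed_vector"
  assumes refl: "reflexive_space TYPE('a)" and bd: "\<And>n. norm (u n) \<le> R"
  obtains r x where "strict_mono (r :: nat \<Rightarrow> nat)" "weakly_converges (u \<circ> r) x"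
proof -
  obtain D where D: "countable D" "subspace (closure D)" "range u \<subseteq> closure D"
    using closed_separable_subspace_containing_seq by metis
  define f :: "'a \<Rightarrow> 'a \<Rightarrow>\<^sub>L real" where "f d = (SOME f :: 'a \<Rightarrow>\<^sub>L real. (\<forall>x. \<bar>f x\<bar> \<le> norm x) \<and> f d = norm d)" for d
  have "\<exists>f :: 'a \<Rightarrow>\<^sub>L real. (\<forall>x. \<bar>f x\<bar> \<le> norm x) \<and> f d = norm d" for d
    using norming_functional[of d] by metis
  then have f: "\<bar>f d x\<bar> \<le> norm x" "f d d = norm d" for d x
    unfolding f_def by (rule someI2_ex, blast)+
  have "norm (f d (u n)) \<le> R" for n d
    using f(1)[of d "u n"] bd[of n] by simp
  then obtain r where r: "strict_mono (r :: nat \<Rightarrow> nat)"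
      "\<And>d. d \<in> D \<Longrightarrow> \<exists>l. (\<lambda>n. f d (u (r n))) \<longlonglongrightarrow> l"
    using function_convergent_subsequence[OF D(1), of "\<lambda>n d. f d (u n)" R] by metis
  let ?w = "u \<circ> r"
  have bdw: "norm (?w n) \<le> R" for n using bd by simp
  \<comment> \<open>At a cluster point every functional is at most its upper limit along
    \<open>?w\<close>; the same for its negative bounds it below by the lower limit.\<close>
  define cluster where "cluster x \<longleftrightarrow>
    (\<forall>(\<psi> :: 'a \<Rightarrow>\<^sub>L real) c. (\<forall>\<^sub>F n in sequentially. \<psi> (?w n) \<le> c) \<longrightarrow> \<psi> x \<le> c)" for x
  have clu: "\<psi> x \<le> c" if "cluster x" "\<forall>\<^sub>F n in sequentially. \<psi> (?w n) \<le> c"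
    for x c and \<psi> :: "'a \<Rightarrow>\<^sub>L real"
    using that unfolding cluster_def by blast
  have lim: "\<psi> x = l" if "cluster x" "(\<lambda>n. \<psi> (?w n)) \<longlonglongrightarrow> l" for x l and \<psi> :: "'a \<Rightarrow>\<^sub>L real"
  proof -
    have half: "\<eta> x \<le> m" if l: "(\<lambda>n. \<eta> (?w n)) \<longlonglongrightarrow> m" for m and \<eta> :: "'a \<Rightarrow>\<^sub>L real"
    proof (rule field_le_epsilon)
      fix e :: real assume "0 < e"
      then have "\<forall>\<^sub>F n in sequentially. \<eta> (?w n) < m + e" by (intro order_tendstoD[OF l]) simp
      then show "\<eta> x \<le> m + e" by (intro clu[OF \<open>cluster x\<close>]) (auto elim: eventually_mono)
    qed
    have "(\<lambda>n. (- \<psi>) (?w n)) \<longlonglongrightarrow> - l"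
      using tendsto_minus[OF that(2)] by (simp add: blinfun.minus_left)
    then show ?thesis using half[OF that(2)] half[of "- \<psi>" "- l"] by (simp add: blinfun.minus_left)
  qed
  have mem: "x \<in> closure D" if "cluster x" for x
  proof (rule ccontr)
    assume "x \<notin> closure D"
    then obtain g :: "'a \<Rightarrow>\<^sub>L real" where g: "\<And>x. x \<in> closure D \<Longrightarrow> g x = 0" "g x \<noteq> 0"
      using separating_functional[OF D(2)] by auto
    have "g (?w n) = 0" for n using D(3) by (auto intro: g(1))
    then have "g x = 0" using lim[OF that, of g 0] by simp
    then show False using g(2) by simp
  qed
  have uniq: "x = y" if xy: "cluster x" "cluster y" for x y
  proof -
    have z: "x - y \<in> closure D" using subspace_diff[OF D(2)] mem xy by blast
    have fz: "f d (x - y) = 0" if d: "d \<in> D" for d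
    proof -
      obtain l where "(\<lambda>n. f d (?w n)) \<longlonglongrightarrow> l" using r(2)[OF d] by auto
      then show ?thesis using lim xy by (simp add: blinfun.diff_right)
    qed
    have "norm (x - y) \<le> 0 + e" if e: "0 < e" for e
    proof -
      \<comment> \<open>A point \<open>d\<close> of \<open>D\<close> near \<open>x - y\<close> has
        small norm, since \<open>f d\<close> norms \<open>d\<close> and vanishes at
        \<open>x - y\<close>.\<close>
      obtain d where d: "d \<in> D" "dist d (x - y) < e/2"
        using z e unfolding closure_approachable by (meson half_gt_zero)
      have "norm d = f d (d - (x - y))" using fz[OF d(1)] f(2)[of d] by (simp add: blinfun.diff_right)
      also have "\<dots> \<le> dist d (x - y)" using f(1)[of d "d - (x - y)"] by (simp add: dist_norm)
      finally have "norm d < e/2" using d(2) by simp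
      moreover have "norm (x - y) \<le> norm d + dist d (x - y)"
        by (metis dist_0_norm dist_commute dist_triangle)
      ultimately show ?thesis using d(2) by simp
    qed
    then have "norm (x - y) \<le> 0" by (rule field_le_epsilon)
    then show ?thesis by simp
  qed
  obtain x where x: "cluster x"
    using reflexive_space_limsup_attained[OF refl, of ?w R 0] bdw unfolding cluster_def by metis
  have up: "\<forall>\<^sub>F n in sequentially. \<psi> (?w n) < c" if c: "\<psi> x < c" for c and \<psi> :: "'a \<Rightarrow>\<^sub>L real"
  proof -
    \<comment> \<open>This cluster point is chosen to attain the upper limit of
      \<open>\<psi>\<close>; uniqueness then identifies it with \<open>x\<close>.\<close>
    obtain y where y: "cluster y" "\<And>c. \<psi> y < c \<Longrightarrow> \<forall>\<^sub>F n in sequentially. \<psi> (?w n) \<le> c"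
      using reflexive_space_limsup_attained[OF refl, of ?w R \<psi>] bdw unfolding cluster_def by metis
    obtain b where "\<psi> x < b" "b < c" using dense[OF c] by blast
    then show ?thesis using y(2)[of b] uniq[OF x y(1)] by (auto elim!: eventually_mono)
  qed
  have "weakly_converges ?w x"
    unfolding weakly_converges_def
  proof (intro allI order_tendstoI)
    fix \<psi> :: "'a \<Rightarrow>\<^sub>L real" and c
    show "\<psi> x < c \<Longrightarrow> \<forall>\<^sub>F n in sequentially. \<psi> (?w n) < c" by (rule up)
    show "c < \<psi> x \<Longrightarrow> \<forall>\<^sub>F n in sequentially. c < \<psi> (?w n)"
      using up[of "- \<psi>" "- c"] by (simp add: blinfun.minus_left)
  qed
  then show thesis using that r(1) by blast
qed

text \<open>The direct method: coercivity bounds a minimizing sequence, and lower semicontinuity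
  passes to a weak limit.\<close>

theorem seq_weakly_lsc_coercive_attains_inf:
  fixes I :: "'a::real_normed_vector \<Rightarrow> real"
  assumes refl: "reflexive_space TYPE('a)" and lsc: "seq_weakly_lsc I" and co: "coercive I"
  obtains x where "\<And>y. I x \<le> I y"
proof -
  obtain b where b: "\<And>x. norm x \<ge> b \<Longrightarrow> I x \<ge> I 0 + 1"
    using co unfolding coercive_def filterlim_at_top eventually_at_infinity by meson
  \<comment> \<open>The infimum is taken in the extended reals because boundedness below is not yet
    known; it follows from comparison with the value at the weak limit.\<close>
  define \<mu> where "\<mu> = (INF x. ereal (I x))"
  obtain v where v: "\<And>n. v n \<in> range (\<lambda>x. ereal (I x))" "v \<longlonglongrightarrow> \<mu>"
    using Inf_as_limit[of "range (\<lambda>x. ereal (I x))"] unfolding \<mu>_def by auto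
  then have "\<forall>n. \<exists>x. v n = ereal (I x)" by blast
  then obtain u where u: "\<And>n. v n = ereal (I (u n))" by metis
  have "\<mu> < ereal (I 0 + 1)"
    by (rule le_less_trans[of _ "ereal (I 0)"]) (auto simp: \<mu>_def intro: INF_lower)
  then have "\<forall>\<^sub>F n in sequentially. v n < ereal (I 0 + 1)" by (rule order_tendstoD[OF v(2)])
  then obtain N where N: "\<And>n. n \<ge> N \<Longrightarrow> I (u n) < I 0 + 1"
    unfolding eventually_sequentially u by auto
  have "norm (u (n + N)) \<le> b" for n using b[of "u (n + N)"] N[of "n + N"] by force
  then obtain r x where r: "strict_mono (r :: nat \<Rightarrow> nat)"
      "weakly_converges ((\<lambda>n. u (n + N)) \<circ> r) x"
    using reflexive_space_bounded_seq[OF refl, of "\<lambda>n. u (n + N)" b] by metis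
  have "(\<lambda>n. v (r n + N)) \<longlonglongrightarrow> \<mu>"
    using LIMSEQ_subseq_LIMSEQ[OF LIMSEQ_ignore_initial_segment[OF v(2), of N] r(1)]
    by (simp add: o_def)
  then have "liminf (\<lambda>n. ereal (I (((\<lambda>n. u (n + N)) \<circ> r) n))) = \<mu>"
    by (intro lim_imp_Liminf) (simp_all add: u)
  then have "ereal (I x) \<le> \<mu>" using lsc r(2) unfolding seq_weakly_lsc_def by metis
  moreover have "\<mu> \<le> ereal (I y)" for y unfolding \<mu>_def by (rule INF_lower) simp
  ultimately have "I x \<le> I y" for y by (metis ereal_less_eq(3) order_trans)
  then show thesis by (rule that)
qed

section \<open>Linear perturbations and critical points\<close>

lemma seq_weakly_lsc_add_blinfun:
  fixes \<phi> :: "'a::real_normed_vector \<Rightarrow>\<^sub>L real"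
  assumes "seq_weakly_lsc I"
  shows "seq_weakly_lsc (\<lambda>x. I x + \<phi> x)"
  unfolding seq_weakly_lsc_def
proof (intro allI impI)
  fix u and x :: 'a assume w: "weakly_converges u x"
  have lim: "(\<lambda>n. ereal (\<phi> (u n))) \<longlonglongrightarrow> ereal (\<phi> x)" using w by (simp add: weakly_converges_def)
  have "ereal (I x + \<phi> x) = ereal (\<phi> x) + ereal (I x)" by simp
  also have "\<dots> \<le> ereal (\<phi> x) + liminf (\<lambda>n. ereal (I (u n)))"
    using assms w by (intro add_left_mono) (simp add: seq_weakly_lsc_def)
  also have "\<dots> = liminf (\<lambda>n. ereal (\<phi> (u n)) + ereal (I (u n)))"
    by (rule ereal_liminf_lim_add[OF lim, symmetric]) simp
  finally show "ereal (I x + \<phi> x) \<le> liminf (\<lambda>n. ereal (I (u n) + \<phi> (u n)))"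
    by (simp add: add.commute)
qed

text \<open>Minimality bounds the right difference quotients in direction \<open>v\<close> below by
  \<open>\<phi> v\<close>; the direction \<open>- v\<close> gives the opposite inequality.\<close>

lemma has_gateaux_derivative_minimum:
  fixes D \<phi> :: "'a::real_normed_vector \<Rightarrow>\<^sub>L real"
  assumes g: "has_gateaux_derivative I D x" and min: "\<And>y. I x - \<phi> x \<le> I y - \<phi> y"
  shows "D = \<phi>"
proof -
  have le: "\<phi> v \<le> D v" for v
  proof (rule tendsto_lowerbound)
    have "((\<lambda>t. (I (x + t *\<^sub>R v) - I x) / t) \<longlongrightarrow> D v) (at 0)"
      using g by (simp add: has_gateaux_derivative_def)
    then show "((\<lambda>t. (I (x + t *\<^sub>R v) - I x) / t) \<longlongrightarrow> D v) (at_right 0)"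
      by (rule filterlim_mono) (auto simp: at_within_le_nhds intro: at_le)
    have "\<phi> v \<le> (I (x + t *\<^sub>R v) - I x) / t" if "t > 0" for t
      using min[of "x + t *\<^sub>R v"] that
      by (simp add: field_simps blinfun.add_right blinfun.scaleR_right)
    then show "\<forall>\<^sub>F t in at_right 0. \<phi> v \<le> (I (x + t *\<^sub>R v) - I x) / t"
      by (auto simp: eventually_at_filter)
  qed simp
  show ?thesis
  proof (rule blinfun_eqI)
    show "D v = \<phi> v" for v
      using le[of v] le[of "- v"] by (simp add: blinfun.minus_right)
  qed
qed

section \<open>Complements of \<open>\<sigma>\<close>-compact sets\<close>

text \<open>A functional vanishing on \<open>span B\<close> but not at \<open>v\<close> defines a
  continuous projection \<open>P\<close> along \<open>v\<close>, and the enlarged span is the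
  preimage of \<open>span B\<close> under \<open>P\<close>.\<close>

lemma closed_span_finite:
  fixes B :: "'a::real_normed_vector set"
  assumes "finite B"
  shows "closed (span B)"
  using assms
proof (induction B)
  case (insert v B)
  show ?case
  proof (cases "v \<in> span B")
    case True
    then show ?thesis using insert by (simp add: span_redundant)
  next
    case False
    then obtain f :: "'a \<Rightarrow>\<^sub>L real" where f: "\<And>x. x \<in> span B \<Longrightarrow> f x = 0" "f v \<noteq> 0"
      using separating_functional[OF subspace_span insert.IH] by metis
    define P where "P x = x - (f x / f v) *\<^sub>R v" for x
    have "continuous_on UNIV P"
      unfolding P_def using f(2) by (intro continuous_intros) auto
    then have "closed (P -` span B)"
      using insert.IH by (intro closed_vimage) (auto simp: continuous_on_eq_continuous_at)
    moreover have "P -` span B = span (insert v B)"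
    proof (intro equalityI subsetI)
      fix x assume "x \<in> P -` span B"
      then have "P x \<in> span B" by simp
      then show "x \<in> span (insert v B)" unfolding P_def span_insert by blast
    next
      fix x assume "x \<in> span (insert v B)"
      then obtain k where k: "x - k *\<^sub>R v \<in> span B" unfolding span_insert by blast
      then have "f x = k * f v" using f(1)[OF k] by (simp add: blinfun.diff_right blinfun.scaleR_right)
      then show "x \<in> P -` span B" using k f(2) by (simp add: P_def)
    qed
    ultimately show ?thesis by simp
  qed
qed simp

text \<open>Riesz's argument: if a compact set contained a ball, finitely many balls of half the
  radius would cover it, and the closed span of their centres together with \<open>c\<close> would
  be the whole space.\<close>

theorem infinite_dimensional_compact_interior:
  fixes C :: "'a::real_normed_vector set"
  assumes inf: "infinite_dimensional TYPE('a)" and C: "compact C"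
  shows "interior C = {}"
proof (rule ccontr)
  assume "interior C \<noteq> {}"
  then obtain c e where e: "e > 0" "cball c e \<subseteq> C"
    by (meson equals0I mem_interior_cball)
  have cover: "C \<subseteq> (\<Union>x\<in>C. ball x (e/2))" using e by auto
  obtain F where F: "finite F" "F \<subseteq> C" "C \<subseteq> (\<Union>x\<in>F. ball x (e/2))"
    using compactE_image[OF C _ cover] by (metis open_ball)
  let ?M = "span (insert c F)"
  have M: "closed ?M" "?M \<noteq> {}" using F(1) span_zero by (auto intro: closed_span_finite)
  \<comment> \<open>Rescaling to the ball of radius \<open>e\<close> and approximating by \<open>F\<close> halves the distance to \<open>?M\<close>.\<close>
  have "infdist y ?M = 0" for y
  proof (rule ccontr)
    assume "infdist y ?M \<noteq> 0"
    then have d: "infdist y ?M > 0" using infdist_nonneg[of y ?M] by linarith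
    \<comment> \<open>The factor 2 matches the halving below: a new point at distance less than
      \<open>t / 2\<close> beats the infimum.\<close>
    then obtain a where a: "a \<in> ?M" "dist y a < 2 * infdist y ?M"
      using infdist_lessE[of y ?M "2 * infdist y ?M"] M(2) by auto
    define t where "t = dist y a"
    have t: "t > 0" unfolding t_def using d infdist_le[OF a(1), of y] by linarith
    have "c + (e / t) *\<^sub>R (y - a) \<in> C"
      using e t by (intro subsetD[OF e(2)]) (simp add: dist_norm t_def)
    then obtain x where x: "x \<in> F" "dist x (c + (e / t) *\<^sub>R (y - a)) < e/2"
      using F(3) by auto
    have m: "a + (t / e) *\<^sub>R (x - c) \<in> ?M"
      using a(1) x(1) by (intro span_add span_scale span_diff) (auto intro: span_base)
    have "y - (a + (t / e) *\<^sub>R (x - c)) = (t / e) *\<^sub>R (c + (e / t) *\<^sub>R (y - a) - x)"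
      using t e by (simp add: algebra_simps)
    then have "dist y (a + (t / e) *\<^sub>R (x - c)) = (t / e) * dist x (c + (e / t) *\<^sub>R (y - a))"
      using t e by (simp add: dist_norm norm_minus_commute)
    also have "\<dots> < (t / e) * (e / 2)" using x(2) t e by (intro mult_strict_left_mono) auto
    also have "\<dots> = t / 2" using e by simp
    also have "\<dots> < infdist y ?M" using a(2) by (simp add: t_def)
    finally show False using infdist_le[OF m, of y] by simp
  qed
  then have "?M = UNIV" using in_closed_iff_infdist_zero[OF M] by auto
  then show False using inf F(1) unfolding infinite_dimensional_def by blast
qed

section \<open>Stability and thinness of sigma-compact sets\<close>

lemma sigma_compact_compact: "compact S \<Longrightarrow> sigma_compact S"
  unfolding sigma_compact_def by (intro exI[where x = "{S}"]) auto

lemma sigma_compact_UN: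
  assumes "countable I" "\<And>i. i \<in> I \<Longrightarrow> sigma_compact (S i)"
  shows "sigma_compact (\<Union>i\<in>I. S i)"
proof -
  have "\<forall>i\<in>I. \<exists>\<K>. countable \<K> \<and> (\<forall>K\<in>\<K>. compact K) \<and> S i = \<Union>\<K>"
    using assms(2) by (simp add: sigma_compact_def)
  then obtain \<K> where \<K>: "\<And>i. i \<in> I \<Longrightarrow> countable (\<K> i)"
      "\<And>i K. i \<in> I \<Longrightarrow> K \<in> \<K> i \<Longrightarrow> compact K" "\<And>i. i \<in> I \<Longrightarrow> S i = \<Union>(\<K> i)"
    by metis
  show ?thesis unfolding sigma_compact_def
    by (intro exI[where x = "\<Union>i\<in>I. \<K> i"]) (use \<K> assms(1) in auto)
qed

lemma sigma_compact_continuous_image: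
  assumes "sigma_compact S" "continuous_on S f"
  shows "sigma_compact (f ` S)"
proof -
  obtain \<K> where \<K>: "countable \<K>" "\<And>K. K \<in> \<K> \<Longrightarrow> compact K" "S = \<Union>\<K>"
    using assms(1) by (auto simp: sigma_compact_def)
  have "compact (f ` K)" if "K \<in> \<K>" for K
    using \<K> that assms(2) by (intro compact_continuous_image) (auto intro: continuous_on_subset)
  then show ?thesis unfolding sigma_compact_def
    by (intro exI[where x = "image f ` \<K>"]) (use \<K> in auto)
qed

text \<open>This is Baire's theorem, compact sets being closed. Thinness of compact sets is a
  hypothesis so that the result can also serve for the dual, where thinness is obtained by pulling
  back along \<open>T\<close>.\<close>

lemma sigma_compact_interior:
  fixes S :: "'a::{real_normed_vector,complete_space} set"
  assumes thin: "\<And>C :: 'a set. compact C \<Longrightarrow> interior C = {}" and S: "sigma_compact S"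
  shows "interior S = {}"
proof -
  obtain \<K> where \<K>: "countable \<K>" "\<And>K. K \<in> \<K> \<Longrightarrow> compact K" "S = \<Union>\<K>"
    using S by (auto simp: sigma_compact_def)
  have "Met_TC.mtopology interior_of \<Union>\<K> = {}"
    using \<K> thin by (intro Met_TC.metric_Baire_category_alt)
      (auto simp: mcomplete_iff_complete complete_UNIV compact_imp_closed)
  then show ?thesis using \<K>(3) by simp
qed

text \<open>The excluded apices \<open>v\<close> are the points \<open>(k - (1 - s) g) / s\<close> with \<open>k \<in> K\<close>, \<open>g \<in> G\<close> and
  \<open>0 < s \<le> 1\<close>, and these again form a \<open>\<sigma>\<close>-compact set.\<close>

lemma exists_cone_avoiding_sigma_compact:
  fixes K G :: "'a::{real_normed_vector,complete_space} set"
  assumes thin: "\<And>C :: 'a set. compact C \<Longrightarrow> interior C = {}"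
    and K: "sigma_compact K" and G: "compact G" and disj: "G \<inter> K = {}"
  obtains v where "\<And>g. g \<in> G \<Longrightarrow> closed_segment g v \<inter> K = {}"
proof -
  obtain \<K> where \<K>: "countable \<K>" "\<And>C. C \<in> \<K> \<Longrightarrow> compact C" "K = \<Union>\<K>"
    using K by (auto simp: sigma_compact_def)
  define h where "h = (\<lambda>(k, s, g). (1 / s) *\<^sub>R (k - (1 - s) *\<^sub>R g) :: 'a)"
  \<comment> \<open>The parameter is kept away from 0 on each piece, so that \<open>h\<close> is
    continuous on a compact domain; the pieces exhaust all positive parameters.\<close>
  define W where "W = (\<lambda>(C, n). h ` (C \<times> {1 / real (Suc n)..1} \<times> G))"
  have "compact (W (C, n))" if C: "C \<in> \<K>" for C n
    unfolding W_def prod.case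
  proof (rule compact_continuous_image)
    show "continuous_on (C \<times> {1 / real (Suc n)..1} \<times> G) h"
      unfolding h_def case_prod_unfold
      by (intro continuous_intros) (auto simp: order.strict_iff_not)
    show "compact (C \<times> {1 / real (Suc n)..1} \<times> G)"
      by (intro compact_Times \<K>(2)[OF C] G compact_Icc)
  qed
  then have "sigma_compact (\<Union>i\<in>\<K> \<times> UNIV. W i)"
    using \<K>(1) by (intro sigma_compact_UN) (auto intro: sigma_compact_compact)
  then have "(\<Union>i\<in>\<K> \<times> UNIV. W i) \<noteq> UNIV"
    using sigma_compact_interior[OF thin] by force
  then obtain v where v: "v \<notin> (\<Union>i\<in>\<K> \<times> UNIV. W i)" by blast
  have "closed_segment g v \<inter> K = {}" if g: "g \<in> G" for g
  proof (rule ccontr)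
    assume "closed_segment g v \<inter> K \<noteq> {}"
    then obtain s where s: "0 \<le> s" "s \<le> 1" "(1 - s) *\<^sub>R g + s *\<^sub>R v \<in> K"
      unfolding closed_segment_def by auto
    then obtain C where C: "C \<in> \<K>" "(1 - s) *\<^sub>R g + s *\<^sub>R v \<in> C" using \<K>(3) by blast
    have "s \<noteq> 0" using s(3) disj g by auto
    then have "s > 0" using s(1) by simp
    then obtain n where n: "1 / real (Suc n) \<le> s"
      using reals_Archimedean[of s] by (auto simp: inverse_eq_divide dest: less_imp_le)
    have "v = h ((1 - s) *\<^sub>R g + s *\<^sub>R v, s, g)" using \<open>s > 0\<close> by (simp add: h_def)
    then have "v \<in> W (C, n)" unfolding W_def prod.case
      using C(2) g n s(2) by (intro image_eqI) auto
    then show False using v C(1) by blast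
  qed
  then show thesis by (rule that)
qed

text \<open>Two points are joined by segments to a common apex of a cone that avoids
  \<open>K\<close>.\<close>

lemma path_connected_Compl_sigma_compact:
  fixes K :: "'a::{real_normed_vector,complete_space} set"
  assumes thin: "\<And>C :: 'a set. compact C \<Longrightarrow> interior C = {}" and K: "sigma_compact K"
  shows "path_connected (- K)"
  unfolding path_connected_component
proof (intro ballI)
  fix x y assume xy: "x \<in> - K" "y \<in> - K"
  obtain v where v: "\<And>g. g \<in> {x, y} \<Longrightarrow> closed_segment g v \<inter> K = {}"
    by (rule exists_cone_avoiding_sigma_compact[OF thin K, of "{x, y}"]) (use xy in auto)
  have "path_component (- K) g v" if "g \<in> {x, y}" for g
    using v[OF that] by (intro path_component_linepath) (simp add: disjoint_eq_subset_Compl)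
  then show "path_component (- K) x y"
    by (meson insertCI path_component_sym path_component_trans)
qed

text \<open>The image of a loop is compact, so it has a cone avoiding \<open>K\<close>, along which
  the straight-line homotopy shrinks the loop to the apex.\<close>

lemma simply_connected_Compl_sigma_compact:
  fixes K :: "'a::{real_normed_vector,complete_space} set"
  assumes thin: "\<And>C :: 'a set. compact C \<Longrightarrow> interior C = {}" and K: "sigma_compact K"
  shows "simply_connected (- K)"
  unfolding simply_connected_eq_contractible_loop_some
proof (intro conjI allI impI)
  show "path_connected (- K)" by (rule path_connected_Compl_sigma_compact[OF thin K])
next
  fix p :: "real \<Rightarrow> 'a"
  assume "path p \<and> path_image p \<subseteq> - K \<and> pathfinish p = pathstart p"
  then have p: "path p" "path_image p \<subseteq> - K" "pathfinish p = pathstart p" by auto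
  obtain v where v: "\<And>g. g \<in> path_image p \<Longrightarrow> closed_segment g v \<inter> K = {}"
    by (rule exists_cone_avoiding_sigma_compact[OF thin K, of "path_image p"])
      (use p in \<open>auto intro: compact_path_image\<close>)
  have "v \<in> - K" using v[OF pathstart_in_path_image] by auto
  moreover have "homotopic_loops (- K) p (linepath v v)"
  proof (rule homotopic_loops_linear)
    fix t :: real assume "t \<in> {0..1}"
    then have "p t \<in> path_image p" by (auto simp: path_image_def)
    then show "closed_segment (p t) (linepath v v t) \<subseteq> - K"
      using v by (auto simp: linepath_refl)
  qed (use p in auto)
  ultimately show "\<exists>a. a \<in> - K \<and> homotopic_loops (- K) p (linepath a a)" by blast
qed

section \<open>Closed maps, proper maps and coverings\<close>

text \<open>Without a convergent subsequence the range of \<open>x\<close> has no limit point and is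
  closed. Its image is then closed and must contain \<open>y\<close>, a value that the sequence
  omits.\<close>

lemma closed_map_seq_subconvergent:
  fixes f :: "'a::metric_space \<Rightarrow> 'b::metric_space"
  assumes f: "closed_map euclidean euclidean f"
    and lim: "(\<lambda>n. f (x n)) \<longlonglongrightarrow> y" and ne: "\<And>n :: nat. f (x n) \<noteq> y"
  obtains r l where "strict_mono (r :: nat \<Rightarrow> nat)" "(x \<circ> r) \<longlonglongrightarrow> l"
proof (rule ccontr)
  assume no: "\<not> thesis"
  have "closed (range x)"
    unfolding closed_limpt
  proof (intro allI impI, rule ccontr)
    fix l assume "l islimpt range x"
    then have "\<forall>U. l \<in> U \<and> open U \<longrightarrow> infinite (U \<inter> range x)"
      by (simp add: islimpt_eq_acc_point)
    then obtain r where "strict_mono (r :: nat \<Rightarrow> nat)" "(x \<circ> r) \<longlonglongrightarrow> l"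
      using acc_point_range_imp_convergent_subsequence[of l x] by auto
    then show False using no that by blast
  qed
  then have cl: "closed (f ` range x)" using f by (simp add: closed_map_def)
  have "y \<in> f ` range x" by (rule closed_sequentially[OF cl _ lim]) auto
  then show False using ne by auto
qed

text \<open>Each frontier point has a neighbour \<open>z n\<close> outside the fibre with value
  close to \<open>y\<close>. A subsequence of these neighbours converges, and the frontier points
  follow it.\<close>

lemma closed_map_compact_frontier_fibre:
  fixes f :: "'a::metric_space \<Rightarrow> 'b::metric_space"
  assumes f: "closed_map euclidean euclidean f" and cont: "continuous_on UNIV f"
  shows "compact (frontier (f -` {y}))"
  unfolding compact_eq_seq_compact_metric seq_compact_def
proof (intro allI impI)
  fix x :: "nat \<Rightarrow> 'a" assume x: "\<forall>n. x n \<in> frontier (f -` {y})"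
  have cl: "closed (f -` {y})" using cont by (intro closed_vimage) auto
  have "\<exists>z. dist z (x n) < 1 / real (Suc n) \<and> dist (f z) y < 1 / real (Suc n) \<and> f z \<noteq> y" for n
  proof -
    have fx: "f (x n) = y" using x cl by (auto simp: frontier_def)
    have "isCont f (x n)" using cont by (simp add: continuous_on_eq_continuous_at)
    then obtain d where d: "d > 0" "\<And>z. dist z (x n) < d \<Longrightarrow> dist (f z) y < 1 / real (Suc n)"
      unfolding continuous_at_eps_delta fx by (metis of_nat_0_less_iff zero_less_Suc zero_less_divide_1_iff)
    have "x n \<in> closure (- (f -` {y}))"
      using x by (auto simp: frontier_closures)
    then obtain z where "z \<in> - (f -` {y})" "dist z (x n) < min d (1 / real (Suc n))"
      unfolding closure_approachable using d(1)
      by (metis min_less_iff_conj of_nat_0_less_iff zero_less_Suc zero_less_divide_1_iff)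
    then show ?thesis using d(2) by auto
  qed
  then obtain z where z: "\<And>n. dist (z n) (x n) < 1 / real (Suc n)"
      "\<And>n. dist (f (z n)) y < 1 / real (Suc n)" "\<And>n. f (z n) \<noteq> y"
    by metis
  have "(\<lambda>n. f (z n)) \<longlonglongrightarrow> y"
    unfolding tendsto_dist_iff[of _ y]
    by (rule real_tendsto_sandwich[OF _ _ tendsto_const LIMSEQ_Suc[OF lim_1_over_n]])
      (use z(2) in \<open>auto intro!: always_eventually less_imp_le\<close>)
  then obtain r l where r: "strict_mono (r :: nat \<Rightarrow> nat)" "(z \<circ> r) \<longlonglongrightarrow> l"
    using closed_map_seq_subconvergent[OF f, of z y] z(3) by metis
  have "(\<lambda>n. dist (z n) (x n)) \<longlonglongrightarrow> 0"
    by (rule real_tendsto_sandwich[OF _ _ tendsto_const LIMSEQ_Suc[OF lim_1_over_n]])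
      (use z(1) in \<open>auto intro!: always_eventually less_imp_le\<close>)
  then have "(\<lambda>n. dist ((z \<circ> r) n) ((x \<circ> r) n)) \<longlonglongrightarrow> 0"
    using LIMSEQ_subseq_LIMSEQ[OF _ r(1)] by (auto simp: o_def)
  then have "(\<lambda>n. dist ((z \<circ> r) n) ((x \<circ> r) n) + dist ((z \<circ> r) n) l) \<longlonglongrightarrow> 0 + 0"
    using tendsto_add[OF _ r(2)[unfolded tendsto_dist_iff[of _ l]]] by blast
  then have sum: "(\<lambda>n. dist ((z \<circ> r) n) ((x \<circ> r) n) + dist ((z \<circ> r) n) l) \<longlonglongrightarrow> 0" by simp
  have "(\<lambda>n. dist ((x \<circ> r) n) l) \<longlonglongrightarrow> 0"
    by (rule real_tendsto_sandwich[OF _ _ tendsto_const sum])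
      (auto intro!: always_eventually dist_triangle3)
  then have xl: "(x \<circ> r) \<longlonglongrightarrow> l" by (rule tendsto_dist_iff[THEN iffD2])
  moreover have "l \<in> frontier (f -` {y})"
    using closed_sequentially[OF frontier_closed _ xl] x by auto
  ultimately show "\<exists>l\<in>frontier (f -` {y}). \<exists>r. strict_mono r \<and> (x \<circ> r) \<longlonglongrightarrow> l"
    using r(1) by blast
qed

text \<open>The connected complement of the compact frontier is the disjoint union of the interior
  and the exterior of the fibre. The exterior is nonempty, so the interior is empty and the fibre
  equals its frontier.\<close>

lemma closed_map_imp_proper_map:
  fixes f :: "'a::{real_normed_vector,complete_space} \<Rightarrow> 'b::metric_space"
  assumes thin: "\<And>C :: 'a set. compact C \<Longrightarrow> interior C = {}"
    and f: "closed_map euclidean euclidean f" and cont: "continuous_on UNIV f"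
    and nonconst: "\<And>y. f -` {y} \<noteq> UNIV"
  shows "proper_map euclidean euclidean f"
proof -
  have "compact (f -` {y})" for y
  proof -
    let ?F = "f -` {y}"
    have cl: "closed ?F" using cont by (intro closed_vimage) auto
    have cpt: "compact (frontier ?F)" by (rule closed_map_compact_frontier_fibre[OF f cont])
    have "connected (- frontier ?F)"
      by (intro path_connected_imp_connected path_connected_Compl_sigma_compact thin
          sigma_compact_compact cpt)
    then have "interior ?F \<inter> - frontier ?F = {} \<or> - ?F \<inter> - frontier ?F = {}"
      by (rule connectedD) (use cl interior_subset[of ?F] in \<open>auto simp: frontier_def\<close>)
    then have "interior ?F = {} \<or> - ?F = {}"
      using cl interior_subset[of ?F] by (auto simp: frontier_def)
    then have "interior ?F = {}" using nonconst[of y] by auto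
    then show ?thesis using cpt cl by (simp add: frontier_def)
  qed
  then show ?thesis using f by (simp add: proper_map_def vimage_def)
qed

section \<open>Local homeomorphisms and coverings\<close>

lemma proper_map_compact_vimage:
  assumes "proper_map euclidean euclidean f" "compact C"
  shows "compact (f -` C)"
  using compactin_proper_map_preimage[OF assms(1), of C] assms(2) by (simp add: vimage_def)

text \<open>The neighbourhoods in the definition need not be open. After shrinking, the image is
  open in \<open>V\<close> and lies in the interior of \<open>V\<close>, hence is open
  outright.\<close>

lemma local_homeomorphism_at_small:
  assumes T: "local_homeomorphism_at T x" and W: "open W" "x \<in> W" and cont: "continuous_on UNIV T"
  obtains U where "open U" "x \<in> U" "U \<subseteq> W" "open (T ` U)" "\<exists>g. homeomorphism U (T ` U) T g"
proof -
  obtain U V g where U: "x \<in> interior U" "T x \<in> interior V" "homeomorphism U V T g"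
    using T by (auto simp: local_homeomorphism_at_def)
  define N where "N = interior U \<inter> W \<inter> T -` interior V"
  have oN: "open N" unfolding N_def using W(1) cont by (intro open_Int open_vimage) auto
  have NU: "N \<subseteq> U" using interior_subset by (auto simp: N_def)
  have "openin (top_of_set V) (T ` N)"
    by (rule homeomorphism_imp_open_map[OF U(3) open_subset[OF NU oN]])
  then have "openin (top_of_set (interior V)) (T ` N)"
    by (rule openin_subset_trans) (auto simp: N_def interior_subset)
  then have "open (T ` N)" by (simp add: openin_open_eq)
  moreover have "homeomorphism N (T ` N) T g"
    using homeomorphism_of_subsets[OF U(3) NU] homeomorphism_image1[OF U(3)] NU by blast
  ultimately show thesis using that[of N] oN U(1,2) W(2) by (auto simp: N_def)
qed

text \<open>The pair \<open>U\<close>, \<open>V\<close> for \<open>x\<close> serves all nearby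
  points too. The purpose is closedness of the singular set.\<close>

lemma open_local_homeomorphism_at: "open {x. local_homeomorphism_at T x}"
  unfolding open_subopen[of "Collect _"]
proof (intro ballI)
  fix x assume "x \<in> {x. local_homeomorphism_at T x}"
  then obtain U V g where U: "x \<in> interior U" "T x \<in> interior V" "homeomorphism U V T g"
    by (auto simp: local_homeomorphism_at_def)
  have "continuous_on (interior U) T"
    using homeomorphism_cont1[OF U(3)] interior_subset continuous_on_subset by blast
  then have "open (interior U \<inter> T -` interior V)"
    by (rule continuous_open_preimage) auto
  moreover have "interior U \<inter> T -` interior V \<subseteq> {x. local_homeomorphism_at T x}"
    using U(3) by (auto simp: local_homeomorphism_at_def)
  ultimately show "\<exists>N. open N \<and> x \<in> N \<and> N \<subseteq> {x. local_homeomorphism_at T x}"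
    using U(1,2) by blast
qed

text \<open>Fibres over \<open>A\<close> are compact and discrete, hence finite. Their points have
  disjoint neighbourhoods on which \<open>T\<close> is a homeomorphism, and closedness of
  \<open>T\<close> controls what lies elsewhere.\<close>

theorem proper_local_homeomorphism_covering_space:
  fixes T :: "'a::metric_space \<Rightarrow> 'b::metric_space"
  assumes proper: "proper_map euclidean euclidean T" and cont: "continuous_on UNIV T"
    and A: "open A" "A \<subseteq> range T"
    and loc: "\<And>x. T x \<in> A \<Longrightarrow> local_homeomorphism_at T x"
  shows "covering_space (T -` A) T A"
proof (rule covering_spaceI)
  show "continuous_on (T -` A) T" using cont continuous_on_subset by blast
  show "T ` (T -` A) = A" using A(2) by auto
next
  fix y assume y: "y \<in> A"
  define F where "F = T -` {y}"
  have cF: "compact F" unfolding F_def by (intro proper_map_compact_vimage[OF proper]) simp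
  have locF: "local_homeomorphism_at T x" if "x \<in> F" for x
    using that y by (intro loc) (simp add: F_def)
  have Fne: "F \<noteq> {}" using y A(2) by (auto simp: F_def)
  have "finite F"
  proof (rule ccontr)
    assume "infinite F"
    then obtain x where x: "x \<in> F" "x islimpt F"
      using cF by (auto simp: compact_eq_Bolzano_Weierstrass)
    then obtain U g where U: "open U" "x \<in> U" "homeomorphism U (T ` U) T g"
      using local_homeomorphism_at_small[OF locF[OF x(1)] open_UNIV UNIV_I cont] by metis
    then obtain z where z: "z \<in> F" "z \<in> U" "z \<noteq> x" using x(2) unfolding islimpt_def by blast
    then have "T z = T x" using x(1) by (simp add: F_def)
    then show False using z U by (metis homeomorphism_apply1)
  qed
  then have "\<exists>d>0. \<forall>z\<in>F. z \<noteq> x \<longrightarrow> d \<le> dist x z" for x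
    by (rule finite_set_avoid)
  then obtain d where d: "\<And>x. d x > 0" "\<And>x z. z \<in> F \<Longrightarrow> z \<noteq> x \<Longrightarrow> d x \<le> dist x z"
    by metis
  have "\<exists>U. open U \<and> x \<in> U \<and> U \<subseteq> ball x (d x/2) \<and> open (T ` U) \<and> (\<exists>g. homeomorphism U (T ` U) T g)"
    if "x \<in> F" for x
    using local_homeomorphism_at_small[OF locF[OF that] open_ball _ cont, of x "d x/2"] d(1)
    by (metis centre_in_ball half_gt_zero)
  then obtain U where U: "\<And>x. x \<in> F \<Longrightarrow> open (U x)" "\<And>x. x \<in> F \<Longrightarrow> x \<in> U x"
      "\<And>x. x \<in> F \<Longrightarrow> U x \<subseteq> ball x (d x/2)" "\<And>x. x \<in> F \<Longrightarrow> open (T ` U x)"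
      "\<And>x. x \<in> F \<Longrightarrow> \<exists>g. homeomorphism (U x) (T ` U x) T g"
    by metis
  \<comment> \<open>Deleting the closed image of the remaining points confines the preimage of
    \<open>V\<close> to the chosen neighbourhoods; the finite intersection makes each of them reach
    all of \<open>V\<close>.\<close>
  define V where "V = A \<inter> (\<Inter>x\<in>F. T ` U x) - T ` (- (\<Union>x\<in>F. U x))"
  have "closed (- (\<Union>x\<in>F. U x))" using U(1) by (intro closed_Compl open_UN) auto
  then have "closed (T ` (- (\<Union>x\<in>F. U x)))"
    using proper by (simp add: proper_map_def closed_map_def)
  then have oV: "open V"
    unfolding V_def using A(1) U(4) \<open>finite F\<close> by (intro open_Diff open_Int open_INT) auto
  have yV: "y \<in> V"
    unfolding V_def using y U(2) by (force simp: F_def)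
  have VA: "V \<subseteq> A" by (auto simp: V_def)
  let ?v = "(\<lambda>x. U x \<inter> T -` V) ` F"
  have disj: "disjnt (U x) (U z)" if "x \<in> F" "z \<in> F" "x \<noteq> z" for x z
  proof -
    have "False" if "w \<in> ball x (d x/2)" "w \<in> ball z (d z/2)" for w
      using that d(2)[of z x] d(2)[of x z] dist_triangle2[of x z w] \<open>x \<in> F\<close> \<open>z \<in> F\<close> \<open>x \<noteq> z\<close>
      by (simp add: dist_commute)
    then show ?thesis using U(3)[OF that(1)] U(3)[OF that(2)] unfolding disjnt_iff by blast
  qed
  show "\<exists>V. y \<in> V \<and> openin (top_of_set A) V \<and>
      (\<exists>v. \<Union>v = T -` A \<inter> T -` V \<and> (\<forall>u\<in>v. openin (top_of_set (T -` A)) u) \<and>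
        pairwise disjnt v \<and> (\<forall>u\<in>v. \<exists>q. homeomorphism u V T q))"
  proof (intro exI[where x = V] conjI exI[where x = ?v] ballI)
    show "y \<in> V" by (rule yV)
    show "openin (top_of_set A) V" using oV VA by (simp add: open_subset)
    show "\<Union>?v = T -` A \<inter> T -` V" using VA by (auto simp: V_def)
    show "pairwise disjnt ?v"
      unfolding pairwise_image pairwise_def using disj by (auto simp: disjnt_def)
  next
    fix u assume "u \<in> ?v"
    then obtain x where x: "x \<in> F" "u = U x \<inter> T -` V" by auto
    have "open (T -` V)" using cont oV by (rule open_vimage[rotated])
    then show "openin (top_of_set (T -` A)) u"
      using x U(1) VA by (auto intro!: open_subset)
    obtain g where g: "homeomorphism (U x) (T ` U x) T g" using U(5)[OF x(1)] by auto
    have "V \<subseteq> T ` U x" using x(1) by (auto simp: V_def)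
    then have im: "T ` u = V" using x(2) by blast
    have "u \<subseteq> U x" using x(2) by blast
    then have "homeomorphism u V T g"
      by (rule homeomorphism_of_subsets[OF g _ order_refl im])
    then show "\<exists>q. homeomorphism u V T q" by (rule exI[where x = g])
  qed
qed

text \<open>A path in \<open>B\<close> between two points of one fibre projects to a loop that
  contracts in \<open>A\<close>. By monodromy it ends where the constant lift ends.\<close>

lemma covering_space_inj_on:
  fixes p :: "'a::real_normed_vector \<Rightarrow> 'b::real_normed_vector"
  assumes cov: "covering_space B p A" and B: "path_connected B" and A: "simply_connected A"
  shows "inj_on p B"
proof (rule inj_onI)
  fix x z assume xz: "x \<in> B" "z \<in> B" "p x = p z"
  obtain h where h: "path h" "path_image h \<subseteq> B" "pathstart h = x" "pathfinish h = z"
    using B xz unfolding path_connected_def by metis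
  have cont: "continuous_on B p" and im: "p ` B = A"
    using cov by (auto simp: covering_space_imp_continuous covering_space_imp_surjective)
  have ph: "path (p \<circ> h)" "path_image (p \<circ> h) \<subseteq> A"
    using h cont im by (auto intro!: path_continuous_image simp: path_image_compose intro: continuous_on_subset)
  have ends: "pathstart (p \<circ> h) = p x" "pathfinish (p \<circ> h) = p x"
    using h xz by (simp_all add: pathstart_compose pathfinish_compose)
  have hom: "homotopic_paths A (p \<circ> h) (linepath (p x) (p x))"
    using A ph ends unfolding simply_connected_eq_contractible_path by metis
  have lp: "p (linepath x x t) = linepath (p x) (p x) t" for t by (simp add: linepath_refl)
  have "pathfinish h = pathfinish (linepath x x)"
    by (rule covering_space_monodromy[OF cov ph _ _ hom h(1,2)])
      (use h xz im in \<open>auto simp: lp\<close>)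
  then show "x = z" using h(4) by simp
qed

section \<open>Singular points\<close>

theorem theorem1:
  fixes T :: "'a::banach \<Rightarrow> 'a \<Rightarrow>\<^sub>L real"
  assumes "infinite_dimensional TYPE('a)"
    and "reflexive_space TYPE('a)"
    and "continuous_on UNIV T"
    and "potential_operator T"
    and "closed_map euclidean euclidean T"
    and "\<not> monotone_operator T"
    and "seq_weakly_lsc (J_functional T)"
    and "\<forall>\<phi> :: 'a \<Rightarrow>\<^sub>L real. coercive (\<lambda>x. J_functional T x + blinfun_apply \<phi> x)"
  shows "\<not> sigma_compact (singular_points T) \<and> \<not> sigma_compact (T ` singular_points T)"
proof -
  note cont = assms(3) and closedT = assms(5)
  let ?J = "J_functional T"
  have crit: "T x = \<phi>" if "\<And>y. ?J x - \<phi> x \<le> ?J y - \<phi> y" for x and \<phi> :: "'a \<Rightarrow>\<^sub>L real"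
    using assms(4) that has_gateaux_derivative_minimum[of ?J "T x" x \<phi>]
    unfolding potential_operator_def by blast
  \<comment> \<open>The tilt is by \<open>- \<phi>\<close>, so that critical points solve
    \<open>T x = \<phi>\<close>.\<close>
  have minimizer: "\<exists>x. \<forall>y. ?J x - \<phi> x \<le> ?J y - \<phi> y" for \<phi> :: "'a \<Rightarrow>\<^sub>L real"
  proof -
    have "seq_weakly_lsc (\<lambda>x. ?J x + (- \<phi>) x)" by (rule seq_weakly_lsc_add_blinfun[OF assms(7)])
    moreover have "coercive (\<lambda>x. ?J x + (- \<phi>) x)" using assms(8) by blast
    ultimately obtain x where "\<And>y. ?J x + (- \<phi>) x \<le> ?J y + (- \<phi>) y"
      using seq_weakly_lsc_coercive_attains_inf[OF assms(2)] by blast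
    then show ?thesis by (auto simp: blinfun.minus_left)
  qed
  have surj: "range T = UNIV" using minimizer crit by (metis surjI surj_def)
  obtain x0 y0 where non_mono: "(T x0 - T y0) (x0 - y0) < 0"
    using assms(6) by (auto simp: monotone_operator_def not_le)
  have thinX: "interior C = {}" if "compact C" for C :: "'a set"
    by (rule infinite_dimensional_compact_interior[OF assms(1) that])
  have proper: "proper_map euclidean euclidean T"
  proof (rule closed_map_imp_proper_map[OF thinX closedT cont])
    fix y show "T -` {y} \<noteq> UNIV"
    proof
      assume "T -` {y} = UNIV"
      then have "T x0 = T y0" by (metis UNIV_I vimage_singleton_eq)
      then show False using non_mono by simp
    qed
  qed
  \<comment> \<open>Thinness is transferred from the domain: the preimage of a compact set is
    compact by properness, and surjectivity carries the empty interior back.\<close>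
  have thinY: "interior C = {}" if C: "compact C" for C :: "('a \<Rightarrow>\<^sub>L real) set"
  proof -
    have "open (T -` interior C)" using cont by (intro open_vimage) auto
    then have "T -` interior C \<subseteq> interior (T -` C)"
      using interior_subset by (intro interior_maximal) auto
    then have "T -` interior C = {}" using thinX[OF proper_map_compact_vimage[OF proper C]] by simp
    then show ?thesis using surj by (metis image_vimage_eq image_empty inf_top_right)
  qed
  \<comment> \<open>This half suffices, since continuous images of sigma-compact sets are
    sigma-compact.\<close>
  have "\<not> sigma_compact (T ` singular_points T)"
  proof
    define K where "K = T ` singular_points T"
    assume "sigma_compact (T ` singular_points T)"
    then have K: "sigma_compact K" by (simp add: K_def)
    have "closed (singular_points T)"
      using open_local_homeomorphism_at[of T] by (simp add: closed_def singular_points_def Collect_neg_eq)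
    then have closedK: "closed K" using closedT by (simp add: K_def closed_map_def)
    have KX: "sigma_compact (T -` K)"
    proof -
      obtain \<K> where \<K>: "countable \<K>" "\<And>C. C \<in> \<K> \<Longrightarrow> compact C" "K = \<Union>\<K>"
        using K by (auto simp: sigma_compact_def)
      have "T -` K = (\<Union>C\<in>\<K>. T -` C)" using \<K>(3) by auto
      then show ?thesis
        using sigma_compact_UN[OF \<K>(1)] \<K>(2) proper_map_compact_vimage[OF proper] sigma_compact_compact
        by metis
    qed
    have "covering_space (T -` (- K)) T (- K)"
    proof (rule proper_local_homeomorphism_covering_space[OF proper cont])
      show "open (- K)" using closedK by (simp add: open_Compl)
      show "- K \<subseteq> range T" using surj by simp
      fix x assume "T x \<in> - K"
      then show "local_homeomorphism_at T x" by (auto simp: K_def singular_points_def)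
    qed
    moreover have "path_connected (T -` (- K))"
      using path_connected_Compl_sigma_compact[OF thinX KX] by (simp add: vimage_Compl)
    moreover have "simply_connected (- K)"
      by (rule simply_connected_Compl_sigma_compact[OF thinY K])
    ultimately have inj: "inj_on T (T -` (- K))" by (rule covering_space_inj_on)
    \<comment> \<open>A minimizer \<open>z\<close> for the tilt \<open>T x\<close> lies in the fibre
      of \<open>x\<close>, so injectivity identifies it with \<open>x\<close>.\<close>
    have min: "?J x - T x x \<le> ?J y - T x y" if x: "x \<in> T -` (- K)" for x y
    proof -
      obtain z where z: "\<And>y. ?J z - T x z \<le> ?J y - T x y" using minimizer[of "T x"] by blast
      then have "T z = T x" by (rule crit)
      then have "z = x" using inj x by (metis inj_onD vimage_eq)
      then show ?thesis using z by blast
    qed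
    \<comment> \<open>The pairs violating monotonicity form an open set, so density supplies one
      with both points over the complement of \<open>K\<close>.\<close>
    define N where "N = {p. (T (fst p) - T (snd p)) (fst p - snd p) < 0}"
    have cont': "continuous_on UNIV (\<lambda>p. T (h p))" if "continuous_on UNIV h" for h :: "'a \<times> 'a \<Rightarrow> 'a"
      using continuous_on_compose2[OF cont that] by simp
    have "open N"
      unfolding N_def by (intro open_Collect_less continuous_intros cont')
    moreover have "(x0, y0) \<in> N" using non_mono by (simp add: N_def)
    ultimately obtain U V where UV: "open U" "open V" "x0 \<in> U" "y0 \<in> V" "U \<times> V \<subseteq> N"
      using open_prod_elim[of N] by (metis mem_Sigma_iff)
    have dense: "\<exists>x\<in>U. x \<in> T -` (- K)" if "open U" "U \<noteq> {}" for U
      using sigma_compact_interior[OF thinX KX] interior_maximal[of U "T -` K"] that by auto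
    obtain x y where xy: "x \<in> U" "x \<in> T -` (- K)" "y \<in> V" "y \<in> T -` (- K)"
      using dense[of U] dense[of V] UV by auto
    \<comment> \<open>Adding the two minimality inequalities cancels the values of
      \<open>?J\<close>.\<close>
    have "0 \<le> (T x - T y) (x - y)"
      using min[OF xy(2), of y] min[OF xy(4), of x]
      by (simp add: blinfun.diff_left blinfun.diff_right)
    then show False using UV(5) xy(1,3) by (force simp: N_def)
  qed
  then show ?thesis
    using sigma_compact_continuous_image[OF _ continuous_on_subset[OF cont subset_UNIV]] by blast
qed

end
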